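(* Let $M,\kappa\ge 1$ be integers and $\delta>0$, $\eta>0$, $p_t,p_r,p_{syn}>0$ be fixed. For $\varepsilon\in(0,1)$ let $p_{0,\mathrm{sc}}^*,r_{0,\mathrm{sc}}^*$ and $p_{0,\mathrm{mrc}}^*,r_{0,\mathrm{mrc}}^*$ be the optimum transmit power and rate, with no constraints on power and rate, under the SC and MRC schemes, as defined in the context. Then $$\lim_{\varepsilon\to 0^+}\frac{r_{0,\mathrm{mrc}}^*}{r_{0,\mathrm{sc}}^*}=(M!)^{1/(2M)},\qquad \lim_{\varepsilon\to 0^+}\frac{p_{0,\mathrm{mrc}}^*}{p_{0,\mathrm{sc}}^*}=(M!)^{-1/(2M)}.$$
   Context: Put $P=p_t+Mp_r+p_{syn}$ (the circuit power for both SC = selection combining and MRC = maximum ratio combining) and $$\omega_{\mathrm{sc}}=\kappa\delta\big((1-\varepsilon^{1/M})^{-1/\kappa}-1\big),\qquad \omega_{\mathrm{mrc}}=\delta\,(M!)^{1/M}\,\big|\ln(1-\varepsilon^{1/M})\big|.$$ For each scheme $s\in\{\mathrm{sc},\mathrm{mrc}\}$, $p_{0,s}^*$ is the maximizer over $p>0$ of the energy efficiency $\frac{(1-\varepsilon)\log_2(1+\omega_s p)}{p/\eta+P}$ and $r_{0,s}^*=\log_2(1+\omega_s p_{0,s}^* )$. In closed form, $r_{0,s}^*=\frac{1}{\ln 2}\big(\mathcal{W}\big(\frac{\omega_s\eta P-1}{e}\big)+1\big)$ and $p_{0,s}^*=(2^{r_{0,s}^*}-1)/\omega_s$, where $\mathcal{W}$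 is the main branch (values $\ge -1$) of the Lambert W function. Here $M$ is the number of receive antennas, $\kappa$ the number of interferers, $\varepsilon$ the target outage probability, and $\eta$ the amplifier drain efficiency. *)

theory Defs
  imports Complex_Main
begin

definition circuit_power :: "nat \<Rightarrow> real \<Rightarrow> real \<Rightarrow> real \<Rightarrow> real" where
  "circuit_power M p_t p_r p_syn = p_t + real M * p_r + p_syn"

definition omega_sc :: "nat \<Rightarrow> nat \<Rightarrow> real \<Rightarrow> real \<Rightarrow> real" where
  "omega_sc M \<kappa> \<delta> \<epsilon> =
     real \<kappa> * \<delta> * ((1 - \<epsilon> powr (1 / real M)) powr (- 1 / real \<kappa>) - 1)"

definition omega_mrc :: "nat \<Rightarrow> real \<Rightarrow> real \<Rightarrow> real" where
  "omega_mrc M \<delta> \<epsilon> =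
     \<delta> * fact M powr (1 / real M) * \<bar>ln (1 - \<epsilon> powr (1 / real M))\<bar>"

definition energy_efficiency :: "real \<Rightarrow> real \<Rightarrow> real \<Rightarrow> real \<Rightarrow> real \<Rightarrow> real" where
  "energy_efficiency \<epsilon> \<omega> \<eta> P p = (1 - \<epsilon>) * log 2 (1 + \<omega> * p) / (p / \<eta> + P)"

(* For 0 < \<epsilon> < 1 and positive \<omega>, \<eta>, P the maximizer over p > 0 exists and is unique,
   so the description below denotes it. *)
definition opt_power :: "real \<Rightarrow> real \<Rightarrow> real \<Rightarrow> real \<Rightarrow> real" where
  "opt_power \<epsilon> \<omega> \<eta> P = (THE p. is_arg_max (energy_efficiency \<epsilon> \<omega> \<eta> P) (\<lambda>p. p > 0) p)"

definition opt_rate :: "real \<Rightarrow> real \<Rightarrow> real \<Rightarrow> real \<Rightarrow> real" where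
  "opt_rate \<epsilon> \<omega> \<eta> P = log 2 (1 + \<omega> * opt_power \<epsilon> \<omega> \<eta> P)"

definition opt_power_sc ::
    "nat \<Rightarrow> nat \<Rightarrow> real \<Rightarrow> real \<Rightarrow> real \<Rightarrow> real \<Rightarrow> real \<Rightarrow> real \<Rightarrow> real" where
  "opt_power_sc M \<kappa> \<delta> \<eta> p_t p_r p_syn \<epsilon> =
     opt_power \<epsilon> (omega_sc M \<kappa> \<delta> \<epsilon>) \<eta> (circuit_power M p_t p_r p_syn)"

definition opt_rate_sc ::
    "nat \<Rightarrow> nat \<Rightarrow> real \<Rightarrow> real \<Rightarrow> real \<Rightarrow> real \<Rightarrow> real \<Rightarrow> real \<Rightarrow> real" where
  "opt_rate_sc M \<kappa> \<delta> \<eta> p_t p_r p_syn \<epsilon> =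
     opt_rate \<epsilon> (omega_sc M \<kappa> \<delta> \<epsilon>) \<eta> (circuit_power M p_t p_r p_syn)"

definition opt_power_mrc ::
    "nat \<Rightarrow> real \<Rightarrow> real \<Rightarrow> real \<Rightarrow> real \<Rightarrow> real \<Rightarrow> real \<Rightarrow> real" where
  "opt_power_mrc M \<delta> \<eta> p_t p_r p_syn \<epsilon> =
     opt_power \<epsilon> (omega_mrc M \<delta> \<epsilon>) \<eta> (circuit_power M p_t p_r p_syn)"

definition opt_rate_mrc ::
    "nat \<Rightarrow> real \<Rightarrow> real \<Rightarrow> real \<Rightarrow> real \<Rightarrow> real \<Rightarrow> real \<Rightarrow> real" where
  "opt_rate_mrc M \<delta> \<eta> p_t p_r p_syn \<epsilon> =
     opt_rate \<epsilon> (omega_mrc M \<delta> \<epsilon>) \<eta> (circuit_power M p_t p_r p_syn)"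

end

theory Submission
  imports Defs "HOL-Real_Asymp.Real_Asymp"
begin

text \<open>
  With \<open>t = ln (1 + \<omega> p)\<close> the energy efficiency is a constant multiple of
  \<open>t / (e\<^sup>t - 1 + c)\<close>, where \<open>c = \<omega> \<eta> P\<close>. The tangent line of \<open>exp\<close> at \<open>t\<^sub>0\<close> shows
  that its unique maximizer is the solution \<open>t\<^sub>0 > 0\<close> of \<open>(t\<^sub>0 - 1) e\<^bsup>t\<^sub>0\<^esup> + 1 = c\<close>.
  The left-hand side is asymptotic to \<open>t\<^sub>0\<^sup>2 / 2\<close>, so \<open>t\<^sub>0\<close> is asymptotic to
  \<open>sqrt (2 c)\<close> as \<open>c \<rightarrow> 0\<close>. Both \<open>\<omega>\<^sub>s\<^sub>c\<close> and \<open>\<omega>\<^sub>m\<^sub>r\<^sub>c / (M!)\<^bsup>1/M\<^esup>\<close> are asymptotic to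
  \<open>\<delta> \<epsilon>\<^bsup>1/M\<^esup>\<close>; hence the rates (proportional to \<open>t\<^sub>0\<close>) have ratio tending to
  \<open>(M!)\<^bsup>1/(2M)\<^esup>\<close>, and the powers (asymptotic to \<open>t\<^sub>0 / \<omega>\<close>) the reciprocal one.
\<close>

section \<open>The stationarity equation\<close>

text \<open>Strict convexity of \<open>exp\<close>: this is 1 + x < exp x at x = t - s, scaled by
  \<open>exp s\<close>. It yields both the monotonicity below and the strict maximality of the
  stationary point.\<close>

lemma exp_gt_tangent:
  fixes t s :: real
  assumes "t \<noteq> s"
  shows "exp s * (1 + t - s) < exp t"
proof -
  have "1 + (t - s) < exp (t - s)"
    using exp_minus_greater[of "s - t"] assms by simp
  then have "exp s * (1 + (t - s)) < exp s * exp (t - s)"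
    by simp
  then show ?thesis
    by (simp add: exp_add[symmetric] algebra_simps)
qed

lemma stationarity_strict_mono:
  fixes s t :: real
  assumes "0 \<le> s" "s < t"
  shows "(s - 1) * exp s + 1 < (t - 1) * exp t + 1"
proof -
  \<comment> \<open>The tangent is taken at the larger point \<open>t\<close>, which leaves only s *
    exp s \<le> s * exp t to add.\<close>
  have "exp t * (1 + s - t) < exp s"
    using exp_gt_tangent[of s t] assms by simp
  moreover have "s * exp s \<le> s * exp t"
    using assms by (intro mult_left_mono) auto
  ultimately show ?thesis
    by (simp add: algebra_simps)
qed

lemma stationarity_solvable:
  fixes c :: real
  assumes "c > 0"
  obtains t where "t > 0" "(t - 1) * exp t + 1 = c"
proof -
  define h where "h = (\<lambda>t::real. (t - 1) * exp t + 1)"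
  \<comment> \<open>At \<open>1 + c\<close> the factor \<open>t - 1\<close> becomes
    \<open>c\<close>, and the exponential is at least 1.\<close>
  have "h (1 + c) \<ge> c"
    using assms mult_left_mono[of 1 "exp (1 + c)" c] by (simp add: h_def add_increasing2)
  moreover have "h 0 \<le> c"
    using assms by (simp add: h_def)
  moreover have "continuous_on {0..1 + c} h"
    unfolding h_def by (intro continuous_intros)
  ultimately obtain t where "0 \<le> t" "h t = c"
    using IVT'[of h 0 c "1 + c"] assms by auto
  moreover from this have "t \<noteq> 0"
    using assms by (auto simp: h_def)
  ultimately show ?thesis
    using that[of t] by (simp add: h_def)
qed

section \<open>The unique maximizer of the energy efficiency\<close>

lemma energy_efficiency_exp:
  assumes "\<omega> > 0" "\<eta> > 0" "P > 0"
  shows "energy_efficiency \<epsilon> \<omega> \<eta> P ((exp t - 1) / \<omega>) =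
    (1 - \<epsilon>) * \<omega> * \<eta> / ln 2 * (t / (exp t - 1 + \<omega> * \<eta> * P))"
proof -
  have "(exp t - 1) / \<omega> / \<eta> + P = (exp t - 1 + \<omega> * \<eta> * P) / (\<omega> * \<eta>)"
    using assms by (simp add: field_simps)
  moreover have "log 2 (1 + \<omega> * ((exp t - 1) / \<omega>)) = t / ln 2"
    using assms by (simp add: log_def)
  ultimately show ?thesis
    by (simp add: energy_efficiency_def)
qed

lemma opt_power_eq:
  assumes "\<epsilon> < 1" "\<omega> > 0" "\<eta> > 0" "P > 0"
    and "t > 0" and t: "(t - 1) * exp t + 1 = \<omega> * \<eta> * P"
  shows "opt_power \<epsilon> \<omega> \<eta> P = (exp t - 1) / \<omega>"
proof -
  define E where "E = energy_efficiency \<epsilon> \<omega> \<eta> P"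
  define p where "p = (exp t - 1) / \<omega>"
  have "p > 0"
    using assms by (simp add: p_def)
  have less: "E q < E p" if "q > 0" "q \<noteq> p" for q
  proof -
    define s where "s = ln (1 + \<omega> * q)"
    have exp_s: "exp s = 1 + \<omega> * q"
      using assms that by (simp add: s_def add_pos_pos)
    then have q: "q = (exp s - 1) / \<omega>"
      using assms by simp
    have "0 < \<omega> * q"
      using assms that by simp
    then have "s > 0"
      by (simp add: s_def)
    have "s \<noteq> t"
      using that q p_def by auto
    then have "exp t * (1 + s - t) < exp s"
      by (rule exp_gt_tangent)
    \<comment> \<open>Stationarity rewrites the tangent inequality as a bound of the quotient at
      \<open>s\<close> by \<open>exp (- t)\<close>. The next equation shows that this bound is
      attained at \<open>t\<close>.\<close>
    then have "s * exp t < exp s - 1 + \<omega> * \<eta> * P"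
      unfolding t[symmetric] by (simp add: algebra_simps)
    moreover have "exp t - 1 + \<omega> * \<eta> * P = t * exp t"
      unfolding t[symmetric] by (simp add: algebra_simps)
    moreover have "0 < s * exp t"
      using \<open>s > 0\<close> by simp
    ultimately have "s / (exp s - 1 + \<omega> * \<eta> * P) < t / (exp t - 1 + \<omega> * \<eta> * P)"
      using \<open>t > 0\<close> by (simp add: field_simps)
    moreover have "0 < (1 - \<epsilon>) * \<omega> * \<eta> / ln 2"
      using assms by simp
    ultimately show ?thesis
      unfolding E_def p_def q using assms
      by (simp only: energy_efficiency_exp mult_strict_left_mono)
  qed
  have "(THE p. is_arg_max E (\<lambda>p. p > 0) p) = p"
  proof (rule the_equality)
    show "is_arg_max E (\<lambda>p. p > 0) p"
      using less \<open>p > 0\<close> unfolding is_arg_max_def by (metis less_asym)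
    show "q = p" if "is_arg_max E (\<lambda>p. p > 0) q" for q
      using less[of q] \<open>p > 0\<close> that unfolding is_arg_max_def by blast
  qed
  then show ?thesis
    by (simp add: opt_power_def E_def p_def)
qed

text \<open>This trades the definite description for an equation: up to the factor
  \<open>ln 2\<close>, the optimum rate is the stationary point, and all later limits rest on these
  three facts.\<close>

lemma opt_rate_stationary:
  assumes "\<epsilon> < 1" "\<omega> > 0" "\<eta> > 0" "P > 0"
  defines "t \<equiv> ln 2 * opt_rate \<epsilon> \<omega> \<eta> P"
  shows "t > 0" "(t - 1) * exp t + 1 = \<omega> * \<eta> * P"
    "opt_power \<epsilon> \<omega> \<eta> P = (exp t - 1) / \<omega>"
proof -
  obtain s where s: "s > 0" "(s - 1) * exp s + 1 = \<omega> * \<eta> * P"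
    using assms by (auto intro: stationarity_solvable[of "\<omega> * \<eta> * P"])
  have p: "opt_power \<epsilon> \<omega> \<eta> P = (exp s - 1) / \<omega>"
    using opt_power_eq[OF assms(1-4) s] .
  then have "t = s"
    using assms by (simp add: t_def opt_rate_def log_def)
  then show "t > 0" "(t - 1) * exp t + 1 = \<omega> * \<eta> * P"
    "opt_power \<epsilon> \<omega> \<eta> P = (exp t - 1) / \<omega>"
    using s p by auto
qed

section \<open>Asymptotics of the stationary point\<close>

text \<open>Strict monotonicity replaces continuity of the inverse function: t \<ge> e would keep
  \<open>c\<close> above a fixed positive value.\<close>

lemma stationary_at_right_0:
  fixes t c :: "'a \<Rightarrow> real"
  assumes t: "eventually (\<lambda>x. t x > 0 \<and> (t x - 1) * exp (t x) + 1 = c x) F"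
    and c: "(c \<longlongrightarrow> 0) F"
  shows "filterlim t (at_right 0) F"
proof -
  have "eventually (\<lambda>x. t x < e) F" if "e > 0" for e
  proof -
    have "(e - 1) * exp e + 1 > 0"
      using stationarity_strict_mono[of 0 e] that by simp
    then have "eventually (\<lambda>x. c x < (e - 1) * exp e + 1) F"
      using c by (rule order_tendstoD(2)[rotated])
    with t show ?thesis
    proof eventually_elim
      case (elim x)
      show ?case
      proof (rule ccontr)
        assume "\<not> t x < e"
        then consider "e = t x" | "e < t x" by linarith
        then show False
          using elim stationarity_strict_mono[of e "t x"] that by cases auto
      qed
    qed
  qed
  moreover have pos: "eventually (\<lambda>x. t x > 0) F"
    using t by eventually_elim simp
  ultimately have "(t \<longlongrightarrow> 0) F"
    by (intro order_tendstoI) (auto elim: eventually_mono)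
  with pos show ?thesis
    by (simp add: filterlim_at eventually_conj_iff eventually_mono)
qed

text \<open>The constant comes from the expansion (t - 1) exp t + 1 = t^2/2 + O(t^3) at 0.\<close>

lemma stationary_asymp:
  fixes t c :: "'a \<Rightarrow> real"
  assumes t: "eventually (\<lambda>x. t x > 0 \<and> (t x - 1) * exp (t x) + 1 = c x) F"
    and c: "(c \<longlongrightarrow> 0) F"
  shows "((\<lambda>x. sqrt (c x) / t x) \<longlongrightarrow> sqrt (1 / 2)) F"
proof -
  have "((\<lambda>t::real. ((t - 1) * exp t + 1) / t ^ 2) \<longlongrightarrow> 1 / 2) (at_right 0)"
    by real_asymp
  then have "((\<lambda>x. ((t x - 1) * exp (t x) + 1) / t x ^ 2) \<longlongrightarrow> 1 / 2) F"
    by (rule filterlim_compose[OF _ stationary_at_right_0[OF t c]])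
  then have "((\<lambda>x. sqrt (((t x - 1) * exp (t x) + 1) / t x ^ 2)) \<longlongrightarrow> sqrt (1 / 2)) F"
    by (rule tendsto_real_sqrt)
  then show ?thesis
  proof (rule Lim_transform_eventually)
    show "eventually (\<lambda>x. sqrt (((t x - 1) * exp (t x) + 1) / t x ^ 2) = sqrt (c x) / t x) F"
      using t by eventually_elim (simp add: real_sqrt_divide)
  qed
qed

text \<open>For small \<omega> the optimum rate grows like sqrt \<omega> and the optimum power like
  1 / sqrt \<omega>, so only the limiting ratio of the two gains enters.\<close>

lemma opt_ratio_limits:
  fixes \<omega>1 \<omega>2 :: "real \<Rightarrow> real"
  assumes "\<eta> > 0" "P > 0" "L > 0"
    and \<omega>1: "filterlim \<omega>1 (at_right 0) (at_right 0)"
    and \<omega>2: "filterlim \<omega>2 (at_right 0) (at_right 0)"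
    and ratio: "((\<lambda>\<epsilon>. \<omega>1 \<epsilon> / \<omega>2 \<epsilon>) \<longlongrightarrow> L) (at_right 0)"
  shows "((\<lambda>\<epsilon>. opt_rate \<epsilon> (\<omega>1 \<epsilon>) \<eta> P / opt_rate \<epsilon> (\<omega>2 \<epsilon>) \<eta> P) \<longlongrightarrow> sqrt L) (at_right 0)"
    and "((\<lambda>\<epsilon>. opt_power \<epsilon> (\<omega>1 \<epsilon>) \<eta> P / opt_power \<epsilon> (\<omega>2 \<epsilon>) \<eta> P) \<longlongrightarrow> 1 / sqrt L) (at_right 0)"
proof -
  let ?F = "at_right (0::real)"
  define t where "t = (\<lambda>\<omega> \<epsilon>. ln 2 * opt_rate \<epsilon> (\<omega> \<epsilon>) \<eta> P)"
  have less1: "eventually (\<lambda>\<epsilon>::real. \<epsilon> < 1) ?F"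
    by (rule order_tendstoD[OF tendsto_ident_at]) simp
  have pos: "eventually (\<lambda>\<epsilon>. \<omega> \<epsilon> > 0) ?F" if "filterlim \<omega> ?F ?F" for \<omega> :: "real \<Rightarrow> real"
    using that by (simp add: filterlim_at eventually_conj_iff)
  have stat: "eventually (\<lambda>\<epsilon>. t \<omega> \<epsilon> > 0 \<and>
      (t \<omega> \<epsilon> - 1) * exp (t \<omega> \<epsilon>) + 1 = \<omega> \<epsilon> * \<eta> * P) ?F"
    and power: "eventually (\<lambda>\<epsilon>. opt_power \<epsilon> (\<omega> \<epsilon>) \<eta> P = (exp (t \<omega> \<epsilon>) - 1) / \<omega> \<epsilon>) ?F"
    if "filterlim \<omega> ?F ?F" for \<omega> :: "real \<Rightarrow> real"
    using less1 pos[OF that] unfolding t_def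
    by (eventually_elim, use assms in \<open>simp add: opt_rate_stationary\<close>)+
  have c0: "((\<lambda>\<epsilon>. \<omega> \<epsilon> * \<eta> * P) \<longlongrightarrow> 0) ?F"
    if "filterlim \<omega> ?F ?F" for \<omega> :: "real \<Rightarrow> real"
    using that by (auto simp: filterlim_at intro!: tendsto_mult_left_zero)
  have asymp: "((\<lambda>\<epsilon>. sqrt (\<omega> \<epsilon> * \<eta> * P) / t \<omega> \<epsilon>) \<longlongrightarrow> sqrt (1 / 2)) ?F"
    and t0: "filterlim (t \<omega>) ?F ?F"
    if "filterlim \<omega> ?F ?F" for \<omega> :: "real \<Rightarrow> real"
    using stationary_asymp[OF stat[OF that] c0[OF that]]
      stationary_at_right_0[OF stat[OF that] c0[OF that]] by auto
  have exp_asymp: "((\<lambda>\<epsilon>. (exp (t \<omega> \<epsilon>) - 1) / t \<omega> \<epsilon>) \<longlongrightarrow> 1) ?F"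
    if "filterlim \<omega> ?F ?F" for \<omega> :: "real \<Rightarrow> real"
  proof -
    have "((\<lambda>t::real. (exp t - 1) / t) \<longlongrightarrow> 1) ?F"
      by real_asymp
    then show ?thesis
      by (rule filterlim_compose[OF _ t0[OF that]])
  qed

  \<comment> \<open>Both factors sqrt c / t have the same nonzero limit, so their quotient tends to
    1; the common \<eta> and P cancel, leaving the square root of the gain ratio.\<close>
  have "((\<lambda>\<epsilon>. (sqrt (\<omega>2 \<epsilon> * \<eta> * P) / t \<omega>2 \<epsilon>) / (sqrt (\<omega>1 \<epsilon> * \<eta> * P) / t \<omega>1 \<epsilon>) * sqrt (\<omega>1 \<epsilon> / \<omega>2 \<epsilon>))
      \<longlongrightarrow> sqrt (1 / 2) / sqrt (1 / 2) * sqrt L) ?F"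
    by (intro tendsto_intros asymp ratio \<omega>1 \<omega>2) simp
  moreover have "eventually (\<lambda>\<epsilon>. (sqrt (\<omega>2 \<epsilon> * \<eta> * P) / t \<omega>2 \<epsilon>) /
      (sqrt (\<omega>1 \<epsilon> * \<eta> * P) / t \<omega>1 \<epsilon>) * sqrt (\<omega>1 \<epsilon> / \<omega>2 \<epsilon>) = t \<omega>1 \<epsilon> / t \<omega>2 \<epsilon>) ?F"
    using pos[OF \<omega>1] pos[OF \<omega>2]
    by eventually_elim (use assms in \<open>simp add: real_sqrt_mult real_sqrt_divide\<close>)
  ultimately have t_ratio: "((\<lambda>\<epsilon>. t \<omega>1 \<epsilon> / t \<omega>2 \<epsilon>) \<longlongrightarrow> sqrt L) ?F"
    using Lim_transform_eventually by fastforce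
  then show "((\<lambda>\<epsilon>. opt_rate \<epsilon> (\<omega>1 \<epsilon>) \<eta> P / opt_rate \<epsilon> (\<omega>2 \<epsilon>) \<eta> P) \<longlongrightarrow> sqrt L) ?F"
    by (simp add: t_def)

  \<comment> \<open>Each power is split as ((exp t - 1) / t) * t / \<omega>, whose first factor
    tends to 1.\<close>
  have "((\<lambda>\<epsilon>. ((exp (t \<omega>1 \<epsilon>) - 1) / t \<omega>1 \<epsilon>) / ((exp (t \<omega>2 \<epsilon>) - 1) / t \<omega>2 \<epsilon>) *
      (t \<omega>1 \<epsilon> / t \<omega>2 \<epsilon>) / (\<omega>1 \<epsilon> / \<omega>2 \<epsilon>)) \<longlongrightarrow> 1 / 1 * sqrt L / L) ?F"
    using \<open>L > 0\<close> by (intro tendsto_intros exp_asymp t_ratio ratio \<omega>1 \<omega>2) auto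
  moreover have "1 / 1 * sqrt L / L = 1 / sqrt L"
    using \<open>L > 0\<close> by (simp add: field_simps)
  moreover have "eventually (\<lambda>\<epsilon>. ((exp (t \<omega>1 \<epsilon>) - 1) / t \<omega>1 \<epsilon>) / ((exp (t \<omega>2 \<epsilon>) - 1) / t \<omega>2 \<epsilon>) *
      (t \<omega>1 \<epsilon> / t \<omega>2 \<epsilon>) / (\<omega>1 \<epsilon> / \<omega>2 \<epsilon>) =
      opt_power \<epsilon> (\<omega>1 \<epsilon>) \<eta> P / opt_power \<epsilon> (\<omega>2 \<epsilon>) \<eta> P) ?F"
    using stat[OF \<omega>1] stat[OF \<omega>2] power[OF \<omega>1] power[OF \<omega>2] pos[OF \<omega>1] pos[OF \<omega>2]
    by eventually_elim simp
  ultimately show "((\<lambda>\<epsilon>. opt_power \<epsilon> (\<omega>1 \<epsilon>) \<eta> P / opt_power \<epsilon> (\<omega>2 \<epsilon>) \<eta> P) \<longlongrightarrow> 1 / sqrt L) ?F"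
    using Lim_transform_eventually by fastforce
qed

section \<open>The gains of the two schemes for small outage probability\<close>

text \<open>It permits the substitution u = \<epsilon> powr (1 / M), through which both gains depend
  on \<epsilon>.\<close>

lemma powr_inverse_at_right_0:
  assumes "M \<ge> 1"
  shows "filterlim (\<lambda>\<epsilon>::real. \<epsilon> powr (1 / real M)) (at_right 0) (at_right 0)"
proof -
  have "1 / real M > 0"
    using assms by simp
  then show ?thesis
    by real_asymp
qed

text \<open>To first order in u, both \<kappa> ((1 - u) powr (-1/\<kappa>) - 1) and the absolute
  value of ln (1 - u) equal u. Hence \<kappa> and \<delta> drop out of the ratio and the factorial
  factor remains.\<close>

lemma omega_limits:
  assumes "M \<ge> 1" "\<kappa> \<ge> 1" "\<delta> > 0"
  shows "filterlim (omega_sc M \<kappa> \<delta>) (at_right 0) (at_right 0)"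
    and "filterlim (omega_mrc M \<delta>) (at_right 0) (at_right 0)"
    and "((\<lambda>\<epsilon>. omega_mrc M \<delta> \<epsilon> / omega_sc M \<kappa> \<delta> \<epsilon>) \<longlongrightarrow> fact M powr (1 / real M)) (at_right 0)"
proof -
  \<comment> \<open>\<open>k\<close> and \<open>A\<close> let the expansions treat the cast and the
    factorial power as plain positive constants.\<close>
  define k where "k = real \<kappa>"
  define A :: real where "A = fact M powr (1 / real M)"
  have pos: "k > 0" "A > 0"
    using assms by (auto simp: k_def A_def)
  have "filterlim (\<lambda>u. k * \<delta> * ((1 - u) powr (- 1 / k) - 1)) (at_right 0) (at_right 0)"
    using pos \<open>\<delta> > 0\<close> by real_asymp
  from filterlim_compose[OF this powr_inverse_at_right_0[OF \<open>M \<ge> 1\<close>]]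
  show "filterlim (omega_sc M \<kappa> \<delta>) (at_right 0) (at_right 0)"
    by (simp add: omega_sc_def[abs_def] k_def)
  have "filterlim (\<lambda>u. \<delta> * A * \<bar>ln (1 - u)\<bar>) (at_right 0) (at_right 0)"
    using pos \<open>\<delta> > 0\<close> by real_asymp
  from filterlim_compose[OF this powr_inverse_at_right_0[OF \<open>M \<ge> 1\<close>]]
  show "filterlim (omega_mrc M \<delta>) (at_right 0) (at_right 0)"
    by (simp add: omega_mrc_def[abs_def] A_def)
  have "((\<lambda>u. (\<delta> * A * \<bar>ln (1 - u)\<bar>) / (k * \<delta> * ((1 - u) powr (- 1 / k) - 1))) \<longlongrightarrow> A) (at_right 0)"
    using pos \<open>\<delta> > 0\<close> by (real_asymp simp: field_simps)
  from filterlim_compose[OF this powr_inverse_at_right_0[OF \<open>M \<ge> 1\<close>]]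
  show "((\<lambda>\<epsilon>. omega_mrc M \<delta> \<epsilon> / omega_sc M \<kappa> \<delta> \<epsilon>) \<longlongrightarrow> fact M powr (1 / real M)) (at_right 0)"
    by (simp add: omega_sc_def omega_mrc_def k_def A_def)
qed

theorem mainTheorem4:
  fixes M \<kappa> :: nat and \<delta> \<eta> p_t p_r p_syn :: real
  assumes "M \<ge> 1" and "\<kappa> \<ge> 1"
    and "\<delta> > 0" and "\<eta> > 0" and "p_t > 0" and "p_r > 0" and "p_syn > 0"
  shows
    "((\<lambda>\<epsilon>. opt_rate_mrc M \<delta> \<eta> p_t p_r p_syn \<epsilon> / opt_rate_sc M \<kappa> \<delta> \<eta> p_t p_r p_syn \<epsilon>)
        \<longlongrightarrow> fact M powr (1 / (2 * real M))) (at_right 0)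
     \<and> ((\<lambda>\<epsilon>. opt_power_mrc M \<delta> \<eta> p_t p_r p_syn \<epsilon> / opt_power_sc M \<kappa> \<delta> \<eta> p_t p_r p_syn \<epsilon>)
        \<longlongrightarrow> fact M powr (- 1 / (2 * real M))) (at_right 0)"
proof -
  define P where "P = circuit_power M p_t p_r p_syn"
  define L :: real where "L = fact M powr (1 / real M)"
  have "P > 0"
    using assms by (simp add: P_def circuit_power_def add_pos_pos)
  moreover have "L > 0"
    by (simp add: L_def)
  moreover have sqrt_L: "sqrt L = fact M powr (1 / (2 * real M))"
    by (simp add: L_def powr_half_sqrt[symmetric] powr_powr mult.commute)
  moreover have "1 / sqrt L = fact M powr (- 1 / (2 * real M))"
    unfolding sqrt_L by (simp add: powr_minus_divide)
  ultimately show ?thesis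
    using opt_ratio_limits[OF \<open>\<eta> > 0\<close>, of P L "omega_mrc M \<delta>" "omega_sc M \<kappa> \<delta>"]
      omega_limits[OF \<open>M \<ge> 1\<close> \<open>\<kappa> \<ge> 1\<close> \<open>\<delta> > 0\<close>]
    by (simp add: opt_rate_mrc_def opt_rate_sc_def opt_power_mrc_def opt_power_sc_def P_def L_def)
qed

end
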